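(* Let $a,b,k_A,k_B$ be positive integers satisfying one of the following: (i) for a given $\varepsilon>0$, $a,b\ge\Delta_0$ where $\Delta_0=\Delta_0(\varepsilon)$ is a suitable constant depending only on $\varepsilon$, and $k_A>b^{\varepsilon}$ and $k_B>a^{\varepsilon}$; (ii) for some real $t>0$, $k_A\ge\frac1t\log_2(2a)$ and $k_B>2^t\log(2b)$; (iii) $a=b=\Delta$ and either $k_B>8\bigl(\Delta/(2\log(2\Delta))\bigr)^{1/k_A}\log(2\Delta)$ or $k_A>8\bigl(\Delta/(2\log(2\Delta))\bigr)^{1/k_B}\log(2\Delta)$. Then the complete bipartite graph $G=(A\cup B,E)$ with $|A|=a$ and $|B|=b$ is $(k_A,k_B)$-choosable. (In (i): for every $\varepsilon>0$ there is $\Delta_0(\varepsilon)$ such that the conclusion holds whenever $a,b\ge\Delta_0$, $k_A>b^\varepsilon$, $k_B>a^\varepsilon$.)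
   Context: $\log$ is the natural logarithm. For a bipartite graph $G=(A\cup B,E)$ with designated parts $A,B$, a $(k_A,k_B)$-list-assignment assigns to each vertex of $A$ a set of $k_A$ positive integers and to each vertex of $B$ a set of $k_B$ positive integers; $G$ is $(k_A,k_B)$-choosable if for every such assignment $L$ there is a proper colouring $c$ with $c(v)\in L(v)$ for all $v$. *)

theory Defs
  imports Complex_Main
begin

text \<open>A finite simple graph is given by its vertex set and a set of two-element edges;
  a bipartite graph comes with its designated (ordered) parts \<open>A\<close> and \<open>B\<close>.\<close>

definition bipartite_graph :: "'v set \<Rightarrow> 'v set \<Rightarrow> 'v set set \<Rightarrow> bool" where
  "bipartite_graph A B E \<longleftrightarrow>
     finite A \<and> finite B \<and> A \<inter> B = {} \<and> (\<forall>e\<in>E. \<exists>x\<in>A. \<exists>y\<in>B. e = {x, y})"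

definition complete_bipartite_graph :: "'v set \<Rightarrow> 'v set \<Rightarrow> 'v set set \<Rightarrow> bool" where
  "complete_bipartite_graph A B E \<longleftrightarrow>
     bipartite_graph A B E \<and> (\<forall>x\<in>A. \<forall>y\<in>B. {x, y} \<in> E)"

text \<open>Colours are positive integers, encoded as positive elements of type \<open>nat\<close>.  The values of
  a list assignment or of a colouring outside the vertex set are irrelevant.\<close>

definition list_assignment ::
  "'v set \<Rightarrow> 'v set \<Rightarrow> nat \<Rightarrow> nat \<Rightarrow> ('v \<Rightarrow> nat set) \<Rightarrow> bool" where
  "list_assignment A B k\<^sub>A k\<^sub>B L \<longleftrightarrow>
     (\<forall>v\<in>A \<union> B. finite (L v) \<and> (\<forall>i\<in>L v. i > 0)) \<and>
     (\<forall>v\<in>A. card (L v) = k\<^sub>A) \<and> (\<forall>v\<in>B. card (L v) = k\<^sub>B)"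

definition proper_colouring :: "'v set set \<Rightarrow> ('v \<Rightarrow> nat) \<Rightarrow> bool" where
  "proper_colouring E c \<longleftrightarrow> (\<forall>x y. {x, y} \<in> E \<longrightarrow> c x \<noteq> c y)"

definition choosable ::
  "'v set \<Rightarrow> 'v set \<Rightarrow> 'v set set \<Rightarrow> nat \<Rightarrow> nat \<Rightarrow> bool" where
  "choosable A B E k\<^sub>A k\<^sub>B \<longleftrightarrow>
     (\<forall>L. list_assignment A B k\<^sub>A k\<^sub>B L \<longrightarrow>
        (\<exists>c. proper_colouring E c \<and> (\<forall>v\<in>A \<union> B. c v \<in> L v)))"

end

theory Submission
  imports Defs "HOL-Real_Asymp.Real_Asymp"
begin

text \<open>Choose a random set \<open>T\<close> of colours, each colour independently with probability \<open>q\<close>, to be used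
  on \<open>B\<close>; the other colours go to \<open>A\<close>.  A vertex of \<open>A\<close> is bad with probability \<open>q ^ kA\<close>, when its
  list lies in \<open>T\<close>, and the number of available colours at a vertex of \<open>B\<close> is binomial with
  parameters \<open>kB\<close> and \<open>q\<close>.  A colouring exists once every vertex of \<open>B\<close> has more available colours
  than there are bad vertices.  Both quantities are controlled by a single first-moment estimate,
  in which the lower tail of the binomial enters through the exponential moment of base \<open>x\<close>;
  \<open>x = 0\<close> asks for no bad vertex and at least one available colour.  Condition (i) reduces to
  the bound behind (ii), applied with the larger part in the role of \<open>A\<close>.\<close>

section \<open>Product weights on the subsets of a finite set\<close>

lemma sum_Pow_prod_if:
  fixes f g :: "'c \<Rightarrow> real"
  assumes "finite U"
  shows "(\<Sum>T\<in>Pow U. \<Prod>i\<in>U. if i \<in> T then f i else g i) = (\<Prod>i\<in>U. f i + g i)"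
  using assms by (subst prod_add) (auto intro!: sum.cong simp: prod.If_cases Int_absorb1 Diff_eq)

text \<open>For \<open>T\<close> inside a finite \<open>U\<close>, this is the probability of
  drawing \<open>T\<close>; weighted sums over \<open>Pow U\<close> then stand for
  expectations.\<close>

definition subset_weight :: "real \<Rightarrow> 'c set \<Rightarrow> 'c set \<Rightarrow> real" where
  "subset_weight q U T = (\<Prod>i\<in>U. if i \<in> T then q else 1 - q)"

lemma subset_weight_nonneg: "0 \<le> q \<Longrightarrow> q \<le> 1 \<Longrightarrow> 0 \<le> subset_weight q U T"
  unfolding subset_weight_def by (intro prod_nonneg) auto

text \<open>Independence of the coordinates, those outside \<open>V\<close> having total weight 1.
  Special cases give the total mass, the probability of containing \<open>V\<close>, and the
  binomial generating function.\<close>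

lemma sum_subset_weight_prod:
  assumes "finite U" "V \<subseteq> U"
  shows "(\<Sum>T\<in>Pow U. subset_weight q U T * (\<Prod>i\<in>V. if i \<in> T then r else s))
    = (q * r + (1 - q) * s) ^ card V"
proof -
  have "subset_weight q U T * (\<Prod>i\<in>V. if i \<in> T then r else s)
     = (\<Prod>i\<in>U. if i \<in> T then q * (if i \<in> V then r else 1) else (1 - q) * (if i \<in> V then s else 1))"
    (is "?l = ?r") for T
  proof -
    have "(\<Prod>i\<in>V. if i \<in> T then r else s)
        = (\<Prod>i\<in>U. if i \<in> V then (if i \<in> T then r else s) else 1)"
      using assms by (simp add: prod.inter_restrict[symmetric] Int_absorb1)
    then show ?thesis
      unfolding subset_weight_def by (simp flip: prod.distrib) (intro prod.cong, auto)
  qed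
  then have "(\<Sum>T\<in>Pow U. subset_weight q U T * (\<Prod>i\<in>V. if i \<in> T then r else s))
     = (\<Prod>i\<in>U. q * (if i \<in> V then r else 1) + (1 - q) * (if i \<in> V then s else 1))"
    using assms by (simp add: sum_Pow_prod_if)
  also have "\<dots> = (\<Prod>i\<in>U. if i \<in> V then q * r + (1 - q) * s else 1)"
    by (intro prod.cong) auto
  also have "\<dots> = (q * r + (1 - q) * s) ^ card V"
    using assms by (simp add: prod.inter_restrict[symmetric] Int_absorb1)
  finally show ?thesis .
qed

lemma sum_subset_weight: "finite U \<Longrightarrow> (\<Sum>T\<in>Pow U. subset_weight q U T) = 1"
  using sum_subset_weight_prod[of U "{}" q 1 1] by simp

lemma sum_subset_weight_subset:
  assumes "finite U" "V \<subseteq> U"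
  shows "(\<Sum>T\<in>Pow U. subset_weight q U T * of_bool (V \<subseteq> T)) = q ^ card V"
proof -
  have "finite V" using assms finite_subset by blast
  then have "(\<Prod>i\<in>V. if i \<in> T then 1 else 0) = (of_bool (V \<subseteq> T) :: real)" for T
    by (induction V) auto
  then show ?thesis
    using sum_subset_weight_prod[OF assms, of q 1 0] by simp
qed

lemma sum_subset_weight_power:
  assumes "finite U" "V \<subseteq> U"
  shows "(\<Sum>T\<in>Pow U. subset_weight q U T * x ^ card (V \<inter> T)) = (q * x + (1 - q)) ^ card V"
proof -
  have "finite V" using assms finite_subset by blast
  then have "(\<Prod>i\<in>V. if i \<in> T then x else 1) = x ^ card (V \<inter> T)" for T
    by (simp add: prod.inter_restrict[symmetric])
  then show ?thesis
    using sum_subset_weight_prod[OF assms, of q x 1] by simp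
qed

section \<open>First-moment criteria for choosability\<close>

text \<open>The left side of \<open>less\<close> is the mean of the quantity in the conclusion, and
  some \<open>T\<close> does no worse than the mean.\<close>

lemma exists_colour_set_of_moment:
  fixes \<alpha> \<beta> q x :: real
  assumes fin: "finite A" "finite B" and L: "list_assignment A B kA kB L"
    and q: "0 \<le> q" "q \<le> 1"
    and less: "\<alpha> * (card A * q ^ kA) + \<beta> * (card B * (q * x + (1 - q)) ^ kB) < 1"
  shows "\<exists>T. \<alpha> * card {v\<in>A. L v \<subseteq> T} + \<beta> * (\<Sum>w\<in>B. x ^ card (L w \<inter> T)) < 1"
proof (rule ccontr)
  \<comment> \<open>Only colours from the lists matter, so a finite sample space suffices.\<close>
  define U where "U = (\<Union>v\<in>A \<union> B. L v)"
  define F where "F T = \<alpha> * card {v\<in>A. L v \<subseteq> T} + \<beta> * (\<Sum>w\<in>B. x ^ card (L w \<inter> T))" for T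
  assume "\<not> ?thesis"
  then have F: "1 \<le> F T" for T
    by (auto simp: F_def not_less)
  have U: "finite U"
    using fin L by (auto simp: U_def list_assignment_def)
  have sub: "L v \<subseteq> U" if "v \<in> A \<union> B" for v
    using that by (auto simp: U_def)
  have bad: "real (card {v\<in>A. L v \<subseteq> T}) = (\<Sum>v\<in>A. of_bool (L v \<subseteq> T))" for T
    using fin by (simp add: of_bool_def sum.If_cases Int_def)
  have "1 = (\<Sum>T\<in>Pow U. subset_weight q U T * 1)"
    using U by (simp add: sum_subset_weight)
  also have "\<dots> \<le> (\<Sum>T\<in>Pow U. subset_weight q U T * F T)"
    using F q by (intro sum_mono mult_left_mono subset_weight_nonneg)
  also have "\<dots> = (\<Sum>T\<in>Pow U. \<alpha> * (\<Sum>v\<in>A. subset_weight q U T * of_bool (L v \<subseteq> T))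
      + \<beta> * (\<Sum>w\<in>B. subset_weight q U T * x ^ card (L w \<inter> T)))"
    unfolding F_def bad by (intro sum.cong refl) (simp add: sum_distrib_left algebra_simps)
  also have "\<dots> = \<alpha> * (\<Sum>v\<in>A. \<Sum>T\<in>Pow U. subset_weight q U T * of_bool (L v \<subseteq> T))
      + \<beta> * (\<Sum>w\<in>B. \<Sum>T\<in>Pow U. subset_weight q U T * x ^ card (L w \<inter> T))"
    by (simp only: sum.distrib sum_distrib_left sum.swap[where A = A and B = "Pow U"]
        sum.swap[where A = B and B = "Pow U"])
  also have "\<dots> = \<alpha> * (\<Sum>v\<in>A. q ^ card (L v)) + \<beta> * (\<Sum>w\<in>B. (q * x + (1 - q)) ^ card (L w))"
    by (intro arg_cong2[where f = "(+)"] arg_cong[where f = "(*) _"] sum.cong refl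
        sum_subset_weight_subset sum_subset_weight_power U sub) simp_all
  also have "\<dots> = \<alpha> * (card A * q ^ kA) + \<beta> * (card B * (q * x + (1 - q)) ^ kB)"
    using L by (simp add: list_assignment_def)
  finally show False using less by simp
qed

text \<open>A vertex of \<open>A\<close> uses a colour outside \<open>T\<close> if it can. Each
  other one takes any colour of its list and blocks at most one colour on \<open>B\<close>, so every
  vertex of \<open>B\<close> keeps a free colour in \<open>T\<close>.\<close>

lemma colouring_of_colour_set:
  assumes G: "bipartite_graph A B E" and L: "list_assignment A B kA kB L" and "kA > 0"
    and T: "\<And>w. w \<in> B \<Longrightarrow> card {v\<in>A. L v \<subseteq> T} < card (L w \<inter> T)"
  shows "\<exists>c. proper_colouring E c \<and> (\<forall>v\<in>A \<union> B. c v \<in> L v)"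
proof -
  define D where "D = {v\<in>A. L v \<subseteq> T}"
  have fin: "finite A" "A \<inter> B = {}" and E: "\<And>e. e \<in> E \<Longrightarrow> \<exists>x\<in>A. \<exists>y\<in>B. e = {x, y}"
    using G by (auto simp: bipartite_graph_def)
  have "\<forall>v\<in>A. \<exists>i. i \<in> L v \<and> (v \<notin> D \<longrightarrow> i \<notin> T)"
  proof
    fix v assume v: "v \<in> A"
    with L \<open>kA > 0\<close> have "L v \<noteq> {}"
      by (auto simp: list_assignment_def)
    then show "\<exists>i. i \<in> L v \<and> (v \<notin> D \<longrightarrow> i \<notin> T)"
      using v by (auto simp: D_def)
  qed
  then obtain f where f: "\<And>v. v \<in> A \<Longrightarrow> f v \<in> L v \<and> (v \<notin> D \<longrightarrow> f v \<notin> T)"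
    by metis
  have "\<forall>w\<in>B. \<exists>i. i \<in> L w \<inter> T \<and> i \<notin> f ` D"
  proof
    fix w assume w: "w \<in> B"
    have finD: "finite D" using fin by (simp add: D_def)
    then have "card (f ` D) < card (L w \<inter> T)"
      using T[OF w] card_image_le[of D f] unfolding D_def by linarith
    then have "\<not> L w \<inter> T \<subseteq> f ` D"
      using card_mono[of "f ` D" "L w \<inter> T"] finD by auto
    then show "\<exists>i. i \<in> L w \<inter> T \<and> i \<notin> f ` D" by blast
  qed
  then obtain g where g: "\<And>w. w \<in> B \<Longrightarrow> g w \<in> L w \<inter> T \<and> g w \<notin> f ` D"
    by metis
  define c where "c v = (if v \<in> A then f v else g v)" for v
  have ne: "f x \<noteq> g y" if "x \<in> A" "y \<in> B" for x y
    using f[OF that(1)] g[OF that(2)] by (metis IntD2 imageI)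
  have "c x \<noteq> c y" if xy: "{x, y} \<in> E" for x y
  proof -
    obtain u w where uw: "u \<in> A" "w \<in> B" "{x, y} = {u, w}"
      using E[OF xy] by blast
    then have "c u \<noteq> c w"
      using ne[of u w] fin(2) by (auto simp: c_def)
    then show ?thesis
      using uw(3) by (auto simp: doubleton_eq_iff)
  qed
  then show ?thesis
    using f g fin(2) unfolding proper_colouring_def
    by (intro exI[of _ c]) (auto simp: c_def)
qed

text \<open>Both summands are nonnegative, so each is below 1 for a suitable \<open>T\<close>. The
  number \<open>1 / \<alpha>\<close> is the common threshold: fewer bad vertices, and by
  \<open>sep\<close> at least that many available colours.\<close>

lemma choosable_of_moment:
  fixes \<alpha> \<beta> q x :: real
  assumes G: "bipartite_graph A B E" and "kA > 0"
    and pos: "\<alpha> > 0" "\<beta> > 0" "0 \<le> x" and q: "0 \<le> q" "q \<le> 1"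
    and less: "\<alpha> * (card A * q ^ kA) + \<beta> * (card B * (q * x + (1 - q)) ^ kB) < 1"
    and sep: "\<And>n::nat. \<beta> * x ^ n < 1 \<Longrightarrow> 1 / \<alpha> \<le> n"
  shows "choosable A B E kA kB"
  unfolding choosable_def
proof (intro allI impI)
  fix L assume L: "list_assignment A B kA kB L"
  have fin: "finite A" "finite B"
    using G by (auto simp: bipartite_graph_def)
  obtain T where T: "\<alpha> * card {v\<in>A. L v \<subseteq> T} + \<beta> * (\<Sum>w\<in>B. x ^ card (L w \<inter> T)) < 1"
    using exists_colour_set_of_moment[OF fin L q less] by blast
  have "0 \<le> \<beta> * (\<Sum>w\<in>B. x ^ card (L w \<inter> T))"
    using pos by (simp add: sum_nonneg)
  then have bad: "card {v\<in>A. L v \<subseteq> T} < 1 / \<alpha>"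
    using T pos by (simp add: field_simps)
  show "\<exists>c. proper_colouring E c \<and> (\<forall>v\<in>A \<union> B. c v \<in> L v)"
  proof (rule colouring_of_colour_set[OF G L \<open>kA > 0\<close>])
    fix w assume w: "w \<in> B"
    have "\<beta> * x ^ card (L w \<inter> T) \<le> \<beta> * (\<Sum>w\<in>B. x ^ card (L w \<inter> T))"
      using fin w pos by (intro mult_left_mono member_le_sum) auto
    also have "\<dots> < 1"
      using T pos by (smt (verit) mult_nonneg_nonneg of_nat_0_le_iff)
    finally have "1 / \<alpha> \<le> card (L w \<inter> T)" by (rule sep)
    with bad have "real (card {v\<in>A. L v \<subseteq> T}) < real (card (L w \<inter> T))" by linarith
    then show "card {v\<in>A. L v \<subseteq> T} < card (L w \<inter> T)" by simp
  qed
qed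

text \<open>With \<open>T = UNIV\<close> all of \<open>A\<close> counts as bad and blocks fewer than
  \<open>kB\<close> colours.\<close>

lemma choosable_of_card_less:
  assumes G: "bipartite_graph A B E" and "kA > 0" and "card A < kB"
  shows "choosable A B E kA kB"
  unfolding choosable_def
proof (intro allI impI)
  fix L assume L: "list_assignment A B kA kB L"
  show "\<exists>c. proper_colouring E c \<and> (\<forall>v\<in>A \<union> B. c v \<in> L v)"
    using assms(3) L
    by (intro colouring_of_colour_set[OF G L \<open>kA > 0\<close>, of UNIV]) (auto simp: list_assignment_def)
qed

lemma bipartite_graph_swap: "bipartite_graph A B E \<Longrightarrow> bipartite_graph B A E"
  unfolding bipartite_graph_def by (metis insert_commute inf_commute)

lemma choosable_swap: "choosable B A E kB kA \<Longrightarrow> choosable A B E kA kB"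
  unfolding choosable_def list_assignment_def by (simp add: Un_commute conj_commute)

lemma power_one_minus_le_exp:
  fixes y :: real
  assumes "y \<le> 1"
  shows "(1 - y) ^ n \<le> exp (- (y * n))"
proof -
  have "(1 - y) ^ n \<le> exp (- y) ^ n"
    using assms exp_ge_add_one_self[of "- y"] by (intro power_mono) auto
  then show ?thesis
    by (simp flip: exp_of_nat_mult add: mult.commute)
qed

lemma powr_inverse_power:
  fixes x :: real
  assumes "x > 0" "n > 0"
  shows "(x powr (1 / n)) ^ n = x"
  using assms powr_power[of x "1 / n" n] by simp

section \<open>The bound behind condition (ii)\<close>

lemma choosable_of_powr_inverse:
  assumes G: "bipartite_graph A B E" and pos: "kA > 0" "card A > 0" "card B > 0"
    and less: "(2 * real (card A)) powr (1 / kA) * ln (2 * real (card B)) < kB"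
  shows "choosable A B E kA kB"
proof (rule choosable_of_moment[OF G pos(1), of 1 1 0])
  \<comment> \<open>Chosen so that the mean number of bad vertices is exactly 1/2; the hypothesis
    then puts the mean number of vertices of \<open>B\<close> without an available colour below
    1/2.\<close>
  let ?q = "(2 * real (card A)) powr (- 1 / kA)"
  show "?q \<le> 1"
    using powr_mono[of "- 1 / kA" 0 "2 * real (card A)"] pos by simp
  have "?q ^ kA = 1 / (2 * card A)"
    using powr_inverse_power[of "2 * real (card A)" kA] pos
    by (simp add: powr_minus_divide power_divide)
  then have A: "card A * ?q ^ kA = 1 / 2"
    using pos by simp
  have "ln (2 * real (card B)) < ?q * kB"
    using less pos by (simp add: powr_minus_divide field_simps)
  then have "exp (- (?q * kB)) < exp (- ln (2 * real (card B)))"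
    by simp
  also have "\<dots> = 1 / (2 * card B)"
    using pos by (simp add: exp_minus field_simps)
  finally have "card B * exp (- (?q * kB)) < 1 / 2"
    using pos by (simp add: field_simps)
  moreover have "card B * (1 - ?q) ^ kB \<le> card B * exp (- (?q * kB))"
    using power_one_minus_le_exp[OF \<open>?q \<le> 1\<close>] by (intro mult_left_mono) auto
  ultimately show "1 * (card A * ?q ^ kA) + 1 * (card B * (?q * 0 + (1 - ?q)) ^ kB) < 1"
    using A by simp
  \<comment> \<open>Since \<open>0 ^ 0 = 1\<close>, the premise excludes exactly
    \<open>n = 0\<close>.\<close>
  show "1 / 1 \<le> real n" if "1 * 0 ^ n < (1::real)" for n
    using that by (cases n) auto
qed auto

text \<open>The condition on \<open>kA\<close> amounts to
  \<open>(2 * card A) powr (1 / kA) \<le> 2 powr t\<close>.\<close>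

lemma choosable_of_powr:
  assumes G: "bipartite_graph A B E" and pos: "kA > 0" "card A > 0" "card B > 0"
    and t: "t > 0" "1 / t * log 2 (2 * real (card A)) \<le> kA"
    and less: "2 powr t * ln (2 * real (card B)) < kB"
  shows "choosable A B E kA kB"
proof (rule choosable_of_powr_inverse[OF G pos])
  have "log 2 (2 * real (card A)) / kA \<le> t"
    using t pos by (simp add: field_simps)
  then have "2 powr (log 2 (2 * real (card A)) / kA) \<le> 2 powr t"
    by simp
  moreover have "2 powr (log 2 (2 * real (card A)) / kA) = (2 * real (card A)) powr (1 / kA)"
    using pos by (simp add: powr_def log_def)
  ultimately have "(2 * real (card A)) powr (1 / kA) * ln (2 * real (card B))
      \<le> 2 powr t * ln (2 * real (card B))"
    using pos by (intro mult_right_mono) auto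
  with less show "(2 * real (card A)) powr (1 / kA) * ln (2 * real (card B)) < kB" by linarith
qed

section \<open>Equal parts, condition (iii)\<close>

text \<open>Makes the factor \<open>4 * ln 2 - 3\<close> negative in the estimate for equal
  parts.\<close>

lemma ln_2_less_three_quarters: "ln (2::real) < 3 / 4"
proof -
  have "2 < exp (3 / 4 :: real)"
    using exp_lower_Taylor_quadratic[of "3 / 4 :: real"] by (simp add: power2_eq_square)
  then have "ln 2 < ln (exp (3 / 4 :: real))"
    by (subst ln_less_cancel_iff) auto
  then show ?thesis by simp
qed

text \<open>Apply \<open>choosable_of_moment\<close> with \<open>x = 1/2\<close>.  With \<open>l = ln (2 \<Delta>)\<close> and \<open>q = 8 l / kB\<close>, the expected number of vertices of \<open>A\<close> with list in
  \<open>T\<close> is at most \<open>2 l\<close>, while the lists of \<open>B\<close> have \<open>8 l\<close> elements in \<open>T\<close> on average; both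
  are compared with \<open>4 l\<close>.  If \<open>q > 1\<close>, then \<open>2 l > \<Delta>\<close> and \<open>kB > 4 \<Delta>\<close>.\<close>

lemma choosable_of_equal_parts:
  fixes \<Delta> :: nat
  assumes G: "bipartite_graph A B E" and pos: "kA > 0" "\<Delta> > 0"
    and card: "card A = \<Delta>" "card B = \<Delta>"
    and less: "8 * (\<Delta> / (2 * ln (2 * real \<Delta>))) powr (1 / kA) * ln (2 * real \<Delta>) < kB"
  shows "choosable A B E kA kB"
proof -
  define l where "l = ln (2 * real \<Delta>)"
  define r where "r = (\<Delta> / (2 * l)) powr (1 / kA)"
  have l: "l > 0" using pos by (simp add: l_def)
  have less': "8 * r * l < kB" using less by (simp add: l_def r_def)
  have base: "0 < \<Delta> / (2 * l)" using l pos by simp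
  have rk: "r ^ kA = \<Delta> / (2 * l)"
    unfolding r_def using base pos(1) by (rule powr_inverse_power)
  have r: "r > 0" unfolding r_def using pos l by simp
  show ?thesis
  proof (cases "8 * l \<le> kB")
    case False
    then have "8 * r * l < 8 * l" using less' by linarith
    then have "r < 1" using l by simp
    \<comment> \<open>As \<open>kA\<close> is at least 1, a base below 1 lets the exponent drop to
      1, which turns the formula for \<open>r ^ kA\<close> into a lower bound on
      \<open>r\<close>.\<close>
    then have "r ^ kA \<le> r ^ 1"
      using r pos by (intro power_decreasing) auto
    then have "\<Delta> / (2 * l) \<le> r" using rk by simp
    then have "4 * real \<Delta> \<le> 8 * r * l" using l by (simp add: field_simps)
    then have "real \<Delta> < real kB" using less' by linarith
    then show ?thesis
      using choosable_of_card_less[OF G pos(1)] card by simp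
  next
    case True
    then have kB: "real kB > 0" using l by linarith
    define q where "q = 8 * l / kB"
    have q: "0 < q" "q \<le> 1" using True l kB by (auto simp: q_def)
    have qk: "q * kB = 8 * l" using kB by (simp add: q_def)
    show ?thesis
    \<comment> \<open>The weights encode the threshold \<open>4 * l\<close>: the second one times
      \<open>(1 / 2) ^ n\<close> is below 1 exactly when \<open>n > 4 * l\<close>.\<close>
    proof (rule choosable_of_moment[OF G pos(1), of "1 / (4 * l)" "2 powr (4 * l)" "1 / 2" q])
      \<comment> \<open>The hypothesis on \<open>kB\<close> says \<open>q < 1 / r\<close>; its power
        bounds the mean number of bad vertices by half the threshold.\<close>
      have "r * q \<le> 1" using less' kB by (simp add: q_def field_simps)
      then have "(r * q) ^ kA \<le> 1"
        using r q by (intro power_le_one) auto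
      then have "\<Delta> * q ^ kA \<le> 2 * l"
        using l by (simp add: power_mult_distrib rk field_simps)
      then have bad: "1 / (4 * l) * (\<Delta> * q ^ kA) \<le> 1 / 2"
        using l by (simp add: field_simps)
      have "(1 - q / 2) ^ kB \<le> exp (- (q / 2 * kB))"
        using q by (intro power_one_minus_le_exp) auto
      also have "\<dots> = exp (- (4 * l))" using qk by simp
      finally have "2 powr (4 * l) * (\<Delta> * (1 - q / 2) ^ kB)
          \<le> 2 powr (4 * l) * (\<Delta> * exp (- (4 * l)))"
        by (intro mult_left_mono) auto
      \<comment> \<open>The exponent collects \<open>4 * l * ln 2\<close> from the weight,
        \<open>l\<close> from \<open>\<Delta> = exp l / 2\<close>, and \<open>- 4 * l\<close> from
        the binomial bound.\<close>
      also have "2 powr (4 * l) * (\<Delta> * exp (- (4 * l))) = exp (l * (4 * ln 2 - 3)) / 2"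
      proof -
        have "real \<Delta> = exp l / 2" using pos by (simp add: l_def)
        then have "2 powr (4 * l) * (\<Delta> * exp (- (4 * l)))
            = exp (4 * l * ln 2) * exp l * exp (- (4 * l)) / 2"
          by (simp add: powr_def)
        then show ?thesis by (simp add: algebra_simps flip: exp_add)
      qed
      also have "\<dots> < 1 / 2"
        using l ln_2_less_three_quarters by (simp add: mult_less_0_iff)
      finally have good: "2 powr (4 * l) * (\<Delta> * (1 - q / 2) ^ kB) < 1 / 2" .
      have "q * (1 / 2) + (1 - q) = 1 - q / 2" by simp
      with bad good show "1 / (4 * l) * (card A * q ^ kA)
          + 2 powr (4 * l) * (card B * (q * (1 / 2) + (1 - q)) ^ kB) < 1"
        by (simp only: card)
      show "1 / (1 / (4 * l)) \<le> real n" if "2 powr (4 * l) * (1 / 2) ^ n < 1" for n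
      proof -
        have "2 powr (4 * l) * (1 / 2) ^ n = 2 powr (4 * l - n)"
          by (simp add: powr_diff powr_realpow power_one_over)
        then have "2 powr (4 * l - n) < 2 powr 0" using that by simp
        then have "4 * l - n < 0" by (subst (asm) powr_less_cancel_iff) auto
        then show ?thesis by simp
      qed
    qed (use l q in auto)
  qed
qed

section \<open>Large parts, condition (i)\<close>

text \<open>Halving the exponent leaves a spare power of \<open>x\<close> that absorbs the
  logarithm. The first inequality later forces \<open>1 / kB \<le> \<epsilon> / 2\<close>.\<close>

lemma eventually_large_parts:
  fixes \<epsilon> :: real
  assumes "\<epsilon> > 0"
  shows "\<exists>D. \<forall>x\<ge>D. 2 / \<epsilon> \<le> x powr \<epsilon> \<and> (2 * x) powr (\<epsilon> / 2) * ln (2 * x) \<le> x powr \<epsilon>"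
proof -
  have "eventually (\<lambda>x. 2 / \<epsilon> \<le> x powr \<epsilon>) at_top"
    using assms by real_asymp
  moreover have "eventually (\<lambda>x. (2 * x) powr (\<epsilon> / 2) * ln (2 * x) \<le> x powr \<epsilon>) at_top"
    using assms by real_asymp
  ultimately have "eventually (\<lambda>x. 2 / \<epsilon> \<le> x powr \<epsilon> \<and>
      (2 * x) powr (\<epsilon> / 2) * ln (2 * x) \<le> x powr \<epsilon>) at_top"
    by (rule eventually_conj)
  then show ?thesis
    by (simp add: eventually_at_top_linorder)
qed

lemma choosable_of_large_parts:
  assumes G: "bipartite_graph A B E" and pos: "kB > 0" "card A > 0" "card A \<le> card B"
    and "\<epsilon> > 0"
    and A: "2 / \<epsilon> \<le> card A powr \<epsilon>"
    and B: "(2 * real (card B)) powr (\<epsilon> / 2) * ln (2 * real (card B)) \<le> card B powr \<epsilon>"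
    and k: "card B powr \<epsilon> < kA" "card A powr \<epsilon> < kB"
  shows "choosable A B E kA kB"
proof (rule choosable_swap, rule choosable_of_powr_inverse)
  show "bipartite_graph B A E" using G by (rule bipartite_graph_swap)
  have "2 / \<epsilon> \<le> kB" using A k by linarith
  then have "1 / kB \<le> \<epsilon> / 2" using \<open>\<epsilon> > 0\<close> pos by (simp add: field_simps)
  \<comment> \<open>Besides the smaller exponent, this uses that \<open>A\<close> is the smaller
    part, so its logarithm is at most that of \<open>B\<close>.\<close>
  then have "(2 * real (card B)) powr (1 / kB) * ln (2 * real (card A))
      \<le> (2 * real (card B)) powr (\<epsilon> / 2) * ln (2 * real (card B))"
    using pos by (intro mult_mono powr_mono) auto
  with B k show "(2 * real (card B)) powr (1 / kB) * ln (2 * real (card A)) < kA"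
    by linarith
qed (use pos in auto)

theorem theorem6p1:
  shows "\<exists>\<Delta>\<^sub>0 :: real \<Rightarrow> real.
    \<forall>(a::nat) (b::nat) (k\<^sub>A::nat) (k\<^sub>B::nat) (A::'v set) (B::'v set) (E::'v set set).
      a > 0 \<longrightarrow> b > 0 \<longrightarrow> k\<^sub>A > 0 \<longrightarrow> k\<^sub>B > 0 \<longrightarrow>
      ((\<exists>\<epsilon>>0. real a \<ge> \<Delta>\<^sub>0 \<epsilon> \<and> real b \<ge> \<Delta>\<^sub>0 \<epsilon> \<and>
           real k\<^sub>A > real b powr \<epsilon> \<and> real k\<^sub>B > real a powr \<epsilon>) \<or>
       (\<exists>t::real. t > 0 \<and> real k\<^sub>A \<ge> 1 / t * log 2 (2 * real a) \<and>
           real k\<^sub>B > 2 powr t * ln (2 * real b)) \<or>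
       (\<exists>\<Delta>::nat. a = \<Delta> \<and> b = \<Delta> \<and>
          (real k\<^sub>B > 8 * (real \<Delta> / (2 * ln (2 * real \<Delta>))) powr (1 / real k\<^sub>A) * ln (2 * real \<Delta>) \<or>
           real k\<^sub>A > 8 * (real \<Delta> / (2 * ln (2 * real \<Delta>))) powr (1 / real k\<^sub>B) * ln (2 * real \<Delta>)))) \<longrightarrow>
      complete_bipartite_graph A B E \<longrightarrow> card A = a \<longrightarrow> card B = b \<longrightarrow>
      choosable A B E k\<^sub>A k\<^sub>B"
proof -
  \<comment> \<open>A choice function makes the threshold depend on \<open>\<epsilon>\<close>
    alone.\<close>
  obtain D where D: "\<And>\<epsilon> x::real. \<epsilon> > 0 \<Longrightarrow> D \<epsilon> \<le> x \<Longrightarrow>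
      2 / \<epsilon> \<le> x powr \<epsilon> \<and> (2 * x) powr (\<epsilon> / 2) * ln (2 * x) \<le> x powr \<epsilon>"
    using eventually_large_parts by metis
  show ?thesis
  proof (intro exI[of _ D] allI impI, elim disjE exE conjE)
    fix a b kA kB :: nat and A B :: "'v set" and E and \<epsilon> :: real
    assume pos: "a > 0" "b > 0" "kA > 0" "kB > 0" and e: "0 < \<epsilon>" "D \<epsilon> \<le> a" "D \<epsilon> \<le> b"
      and k: "b powr \<epsilon> < kA" "a powr \<epsilon> < kB"
      and G: "complete_bipartite_graph A B E" and card: "card A = a" "card B = b"
    have G': "bipartite_graph A B E" using G by (simp add: complete_bipartite_graph_def)
    note D = D[OF e(1,2)] D[OF e(1,3)]
    show "choosable A B E kA kB"
    proof (cases "a \<le> b")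
      case True
      then show ?thesis
        using pos D k card e(1) by (intro choosable_of_large_parts[OF G']) auto
    next
      case False
      then show ?thesis
        using pos D k card e(1) bipartite_graph_swap[OF G']
        by (intro choosable_swap[OF choosable_of_large_parts]) auto
    qed
  next
    fix a b kA kB :: nat and A B :: "'v set" and E and t :: real
    assume "a > 0" "b > 0" "kA > 0" "kB > 0" "0 < t" "1 / t * log 2 (2 * real a) \<le> kA"
      "2 powr t * ln (2 * real b) < kB"
      "complete_bipartite_graph A B E" "card A = a" "card B = b"
    then show "choosable A B E kA kB"
      by (intro choosable_of_powr[of A B E kA t]) (auto simp: complete_bipartite_graph_def)
  next
    fix a b kA kB \<Delta> :: nat and A B :: "'v set" and E
    assume "a > 0" "kA > 0" "a = \<Delta>" "b = \<Delta>"
      "8 * (real \<Delta> / (2 * ln (2 * real \<Delta>))) powr (1 / real kA) * ln (2 * real \<Delta>) < kB"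
      "complete_bipartite_graph A B E" "card A = a" "card B = b"
    then show "choosable A B E kA kB"
      by (intro choosable_of_equal_parts[of A B E kA \<Delta>]) (auto simp: complete_bipartite_graph_def)
  next
    fix a b kA kB \<Delta> :: nat and A B :: "'v set" and E
    assume "a > 0" "kB > 0" "a = \<Delta>" "b = \<Delta>"
      "8 * (real \<Delta> / (2 * ln (2 * real \<Delta>))) powr (1 / real kB) * ln (2 * real \<Delta>) < kA"
      "complete_bipartite_graph A B E" "card A = a" "card B = b"
    then show "choosable A B E kA kB"
      by (intro choosable_swap[OF choosable_of_equal_parts[of B A E kB \<Delta>]])
        (auto simp: complete_bipartite_graph_def bipartite_graph_swap)
  qed
qed

end
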